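(* Let $\delta\in\mathbb C^\times$ and let $(\mathcal B,\ast,\varphi)$ be a $\delta$-differential anti-commutative anti-associative algebra over $\mathbb C$. Define $x\circ y=x\ast\varphi(y)$ for $x,y\in\mathcal B$. Then $(\mathcal B,\circ)$ is a $\delta$-mock-Novikov algebra. Moreover, every fourfold product with respect to $\circ$ (that is, every product of four elements of $\mathcal B$ with respect to $\circ$, with arbitrary bracketing) is zero.
   Context: The ground field is $\mathbb C$ and $\delta\in\mathbb C^\times$. An algebra is a vector space with a bilinear product, not necessarily associative. A $\delta$-differential anti-commutative anti-associative algebra is a triple $(\mathcal B,\ast,\varphi)$ where $(\mathcal B,\ast)$ is an algebra with $x\ast y=-y\ast x$ and $(x\ast y)\ast z=-x\ast(y\ast z)$ for all $x,y,z$, and $\varphi:\mathcal B\to\mathcal B$ is a linear map which is a $\delta$-derivation: $\varphi(x\ast y)=\delta(\varphi(x)\ast y+x\ast\varphi(y))$ for all $x,y\in\mathcal B$. A $\delta$-mock-Novikov algebra is an algebra $(\mathcal A,\circ)$ such that for all $a,b,c\in\mathcal A$ $$\delta(a\circ b)\circ c+\delta(b\circ a)\circ c+a\circ(b\circ c)+b\circ(a\circ c)=0,\qquad (a\circ b)\circ c+(a\circ c)\circ b=0.$$ *)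

theory Defs
  imports Complex_Main
begin

text \<open>Algebras live on a whole type; the scalar multiplication by complex numbers is an explicit
  parameter. No associativity, commutativity or unit is assumed.\<close>

locale complex_algebra = vector_space scale
  for scale :: "complex \<Rightarrow> 'a::ab_group_add \<Rightarrow> 'a" +
  fixes mult :: "'a \<Rightarrow> 'a \<Rightarrow> 'a"
  assumes linear_mult_right: "\<And>x. Vector_Spaces.linear scale scale (\<lambda>y. mult x y)"
    and linear_mult_left: "\<And>y. Vector_Spaces.linear scale scale (\<lambda>x. mult x y)"

locale anticomm_antiassoc_algebra = complex_algebra scale mult
  for scale :: "complex \<Rightarrow> 'a::ab_group_add \<Rightarrow> 'a" and mult :: "'a \<Rightarrow> 'a \<Rightarrow> 'a" +
  assumes anticomm: "\<And>x y. mult x y = - mult y x"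
    and antiassoc: "\<And>x y z. mult (mult x y) z = - mult x (mult y z)"

locale differential_anticomm_antiassoc_algebra = anticomm_antiassoc_algebra scale mult
  for scale :: "complex \<Rightarrow> 'a::ab_group_add \<Rightarrow> 'a" and mult :: "'a \<Rightarrow> 'a \<Rightarrow> 'a" +
  fixes \<delta> :: complex and \<phi> :: "'a \<Rightarrow> 'a"
  assumes linear_derivation: "Vector_Spaces.linear scale scale \<phi>"
    and derivation: "\<And>x y. \<phi> (mult x y) = scale \<delta> (mult (\<phi> x) y + mult x (\<phi> y))"

locale mock_Novikov_algebra = complex_algebra scale mult
  for scale :: "complex \<Rightarrow> 'a::ab_group_add \<Rightarrow> 'a" and mult :: "'a \<Rightarrow> 'a \<Rightarrow> 'a" +
  fixes \<delta> :: complex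
  assumes mock_left:
      "\<And>a b c. scale \<delta> (mult (mult a b) c) + scale \<delta> (mult (mult b a) c)
         + mult a (mult b c) + mult b (mult a c) = 0"
    and mock_right: "\<And>a b c. mult (mult a b) c + mult (mult a c) b = 0"

text \<open>\<open>bracketed_product m xs p\<close>: \<open>p\<close> is the value of the nonempty word \<open>xs\<close> under some complete
  bracketing, products being taken with respect to \<open>m\<close>.\<close>

inductive bracketed_product :: "('a \<Rightarrow> 'a \<Rightarrow> 'a) \<Rightarrow> 'a list \<Rightarrow> 'a \<Rightarrow> bool"
  for m :: "'a \<Rightarrow> 'a \<Rightarrow> 'a" where
  single: "bracketed_product m [x] x"
| product: "bracketed_product m xs p \<Longrightarrow> bracketed_product m ys q
    \<Longrightarrow> bracketed_product m (xs @ ys) (m p q)"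

end

theory Submission
  imports Defs
begin

text \<open>Anti-associativity alone moves a fourfold \<open>\<ast>\<close>-product around the pentagon of bracketings,
  changing sign at each of the five edges, so every such product equals its own negative and
  vanishes. Expanding \<open>\<phi>\<close> by the derivation rule turns a fourfold \<open>\<circ>\<close>-product into a combination
  of fourfold \<open>\<ast>\<close>-products.\<close>

context complex_algebra
begin

lemma mult_add_left: "mult (x + y) z = mult x z + mult y z"
  and mult_scale_left: "mult (scale r x) z = scale r (mult x z)"
  and mult_minus_left: "mult (- x) z = - mult x z"
proof -
  interpret l: Vector_Spaces.linear scale scale "\<lambda>x. mult x z" by (rule linear_mult_left)
  show "mult (x + y) z = mult x z + mult y z" "mult (scale r x) z = scale r (mult x z)"
    "mult (- x) z = - mult x z"
    by (rule l.add l.scale l.neg)+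
qed

lemma mult_add_right: "mult z (x + y) = mult z x + mult z y"
  and mult_scale_right: "mult z (scale r x) = scale r (mult z x)"
  and mult_minus_right: "mult z (- x) = - mult z x"
  and mult_zero_right: "mult z 0 = 0"
proof -
  interpret r: Vector_Spaces.linear scale scale "\<lambda>x. mult z x" by (rule linear_mult_right)
  show "mult z (x + y) = mult z x + mult z y" "mult z (scale r x) = scale r (mult z x)"
    "mult z (- x) = - mult z x" "mult z 0 = 0"
    by (rule r.add r.scale r.neg r.zero)+
qed

lemmas mult_linear_simps =
  mult_add_left mult_scale_left mult_minus_left
  mult_add_right mult_scale_right mult_minus_right mult_zero_right

end

context anticomm_antiassoc_algebra
begin

lemma mult4_zero: "mult a (mult b (mult c d)) = 0"
proof -
  let ?v = "mult a (mult b (mult c d))"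
  have "?v = - mult (mult a b) (mult c d)" by (simp add: antiassoc)
  \<comment> \<open>The instance fixes \<open>mult a b\<close> as one factor, so only the outer
    bracketing moves and \<open>mult a b\<close> stays closed.\<close>
  also have "\<dots> = mult (mult (mult a b) c) d" by (simp only: antiassoc[of "mult a b"])
  \<comment> \<open>Rewriting inside out takes the other side of the pentagon, through
    \<open>(a(bc))d\<close> and \<open>a((bc)d)\<close>: three edges, hence an odd sign. Going back
    through \<open>(ab)(cd)\<close> would only give \<open>?v = ?v\<close>.\<close>
  also have "\<dots> = - ?v" by (simp add: antiassoc mult_linear_simps)
  finally have "?v + ?v = 0" by (metis add.right_inverse)
  then have "scale 2 ?v = 0" using scale_left_distrib[of 1 1 ?v] by simp
  then show ?thesis by simp
qed

end

context differential_anticomm_antiassoc_algebra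
begin

lemma derivation_add: "\<phi> (x + y) = \<phi> x + \<phi> y"
  and derivation_scale: "\<phi> (scale r x) = scale r (\<phi> x)"
  and derivation_minus: "\<phi> (- x) = - \<phi> x"
proof -
  interpret d: Vector_Spaces.linear scale scale \<phi> by (rule linear_derivation)
  show "\<phi> (x + y) = \<phi> x + \<phi> y" "\<phi> (scale r x) = scale r (\<phi> x)" "\<phi> (- x) = - \<phi> x"
    by (rule d.add d.scale d.neg)+
qed

lemma mock_Novikov: "mock_Novikov_algebra scale (\<lambda>x y. mult x (\<phi> y)) \<delta>"
proof (intro mock_Novikov_algebra.intro complex_algebra.intro complex_algebra_axioms.intro
    mock_Novikov_algebra_axioms.intro vector_space_axioms)
  fix x
  show "Vector_Spaces.linear scale scale (\<lambda>y. mult x (\<phi> y))"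
    using Vector_Spaces.linear_compose[OF linear_derivation linear_mult_right[of x]]
    by (simp add: o_def)
next
  fix y
  show "Vector_Spaces.linear scale scale (\<lambda>x. mult x (\<phi> y))" by (rule linear_mult_left)
next
  fix a b c
  \<comment> \<open>Left multiplications anticommute:
    \<open>a(bz) = -(ab)z = (ba)z = -b(az)\<close>.\<close>
  have "mult a (mult b z) + mult b (mult a z) = 0" for z
    using antiassoc[of a b z] antiassoc[of b a z] anticomm[of a b]
    by (metis add.right_inverse minus_minus mult_minus_left)
  then have "scale \<delta> (mult a (mult b (\<phi> (\<phi> c)))) + scale \<delta> (mult b (mult a (\<phi> (\<phi> c)))) = 0"
    by (metis scale_right_distrib scale_zero_right)
  \<comment> \<open>Expanding \<open>\<phi> (mult b (\<phi> c))\<close> gives a term \<delta>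
    \<open>a(\<phi> b \<phi> c)\<close>, which cancels \<delta> \<open>(a \<phi> b) \<phi> c\<close>
    by anti-associativity; likewise with \<open>a\<close> and \<open>b\<close> exchanged. Only the
    terms in \<open>\<phi> (\<phi> c)\<close> remain.\<close>
  then show "scale \<delta> (mult (mult a (\<phi> b)) (\<phi> c)) + scale \<delta> (mult (mult b (\<phi> a)) (\<phi> c))
      + mult a (\<phi> (mult b (\<phi> c))) + mult b (\<phi> (mult a (\<phi> c))) = 0"
    by (simp add: derivation antiassoc mult_linear_simps scale_right_distrib algebra_simps)
next
  fix a b c
  have "mult a (mult (\<phi> b) (\<phi> c)) = - mult a (mult (\<phi> c) (\<phi> b))"
    by (metis anticomm mult_minus_right)
  then show "mult (mult a (\<phi> b)) (\<phi> c) + mult (mult a (\<phi> c)) (\<phi> b) = 0"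
    by (simp add: antiassoc)
qed

end

lemma bracketed_product_nonempty: "bracketed_product m xs p \<Longrightarrow> xs \<noteq> []"
  by (induction rule: bracketed_product.induct) auto

text \<open>Both factors of the outermost product come from nonempty, hence strictly shorter words,
  so shapes can be classified by length. Only the lengths of the subwords are kept: the vanishing
  holds for arbitrary entries.\<close>

lemma bracketed_product_cases:
  assumes "bracketed_product m xs p" "length xs \<noteq> 1"
  obtains ys zs q r where "bracketed_product m ys q" "bracketed_product m zs r"
    "0 < length ys" "0 < length zs" "length xs = length ys + length zs" "p = m q r"
  using assms(1)
proof (cases rule: bracketed_product.cases)
  case (product ys q zs r)
  then show ?thesis using that[of ys q zs r] bracketed_product_nonempty[of m ys q]
      bracketed_product_nonempty[of m zs r] by simp
qed (use assms(2) in simp)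

lemma bracketed_product_2:
  assumes "bracketed_product m xs p" "length xs = 2"
  shows "\<exists>a b. p = m a b"
proof -
  have "length xs \<noteq> 1" using assms(2) by simp
  with assms(1) show ?thesis by (rule bracketed_product_cases) blast
qed

lemma bracketed_product_3:
  assumes "bracketed_product m xs p" "length xs = 3"
  shows "\<exists>a b c. p = m (m a b) c \<or> p = m a (m b c)"
proof -
  have "length xs \<noteq> 1" using assms(2) by simp
  with assms(1) obtain ys zs q r
    where *: "bracketed_product m ys q" "bracketed_product m zs r" "p = m q r"
      "0 < length ys" "0 < length zs" "length xs = length ys + length zs"
    by (rule bracketed_product_cases)
  \<comment> \<open>The other factor has length 1 and serves as an arbitrary element.\<close>
  then have "length ys = 2 \<or> length zs = 2" using assms(2) by linarith
  then show ?thesis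
    using * bracketed_product_2[of m ys q] bracketed_product_2[of m zs r] by blast
qed

text \<open>The splits 3+1, 2+2 and 1+3 contribute two, one and two shapes: the five vertices of the
  pentagon.\<close>

lemma bracketed_product_4:
  assumes "bracketed_product m xs p" "length xs = 4"
  shows "\<exists>a b c d. p = m (m (m a b) c) d \<or> p = m (m a (m b c)) d \<or> p = m (m a b) (m c d)
    \<or> p = m a (m (m b c) d) \<or> p = m a (m b (m c d))"
proof -
  have "length xs \<noteq> 1" using assms(2) by simp
  with assms(1) obtain ys zs q r
    where *: "bracketed_product m ys q" "bracketed_product m zs r" "p = m q r"
      "0 < length ys" "0 < length zs" "length xs = length ys + length zs"
    by (rule bracketed_product_cases)
  then consider "length ys = 3" | "length ys = 2" "length zs = 2" | "length zs = 3"
    using assms(2) by linarith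
  then show ?thesis
  proof cases
    case 1
    then show ?thesis using * bracketed_product_3[of m ys q] by blast
  next
    case 2
    then show ?thesis using * bracketed_product_2[of m ys q] bracketed_product_2[of m zs r] by blast
  next
    case 3
    then show ?thesis using * bracketed_product_3[of m zs r] by blast
  qed
qed

theorem proposition2p11:
  fixes scale :: "complex \<Rightarrow> 'b::ab_group_add \<Rightarrow> 'b"
    and mult :: "'b \<Rightarrow> 'b \<Rightarrow> 'b"
    and \<phi> :: "'b \<Rightarrow> 'b"
    and \<delta> :: complex
    and circ :: "'b \<Rightarrow> 'b \<Rightarrow> 'b"
  assumes "\<delta> \<noteq> 0"
    and "differential_anticomm_antiassoc_algebra scale mult \<delta> \<phi>"
    and "\<And>x y. circ x y = mult x (\<phi> y)"
  shows "mock_Novikov_algebra scale circ \<delta> \<and>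
    (\<forall>xs p. length xs = 4 \<longrightarrow> bracketed_product circ xs p \<longrightarrow> p = 0)"
proof -
  interpret differential_anticomm_antiassoc_algebra scale mult \<delta> \<phi> by (rule assms(2))
  have circ: "circ = (\<lambda>x y. mult x (\<phi> y))" using assms(3) by blast
  \<comment> \<open>In each shape, every summand of the expansion is, up to sign and powers of
    \<delta>, a right-nested product of four elements \<open>\<phi>\<close>-iterated from the
    entries, so \<open>mult4_zero\<close> applies.\<close>
  have "p = 0" if "length xs = 4" "bracketed_product circ xs p" for xs p
    using bracketed_product_4[OF that(2,1)]
    by (auto simp: circ derivation derivation_add derivation_scale derivation_minus antiassoc
        mult_linear_simps mult4_zero)
  then show ?thesis using mock_Novikov circ by blast
qed

end
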